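(* Let $n\ge1$, $m\ge2$, and let $A=(a_{i_1\cdots i_m})\in\overline{\mathbb{R}}^{n^m}$, where $\overline{\mathbb{R}}=\mathbb{R}\cup\{\infty\}$. For each $i\in[n]$ let \[ S_i:=\bigl\{\{i_2,\ldots,i_m\}\ :\ a_{i\,i_2\cdots i_m}\neq\infty\bigr\} \] (the multisets of last $m-1$ indices giving finite entries with first index $i$). Assume the sets $S_1,\ldots,S_n$ are nonempty and mutually equal. Then $A$ has a unique tropical H-eigenvalue $\lambda(A)\in\mathbb{R}$, i.e. there is exactly one $\lambda\in\mathbb{R}$ for which some $x\in\mathbb{R}^n$ satisfies \[ \min_{i_2,\ldots,i_m\in[n]}\bigl(a_{i\, i_2\cdots i_m}+x_{i_2}+\cdots+x_{i_m}\bigr)=\lambda+(m-1)x_i\qquad\text{for all } i=1,\ldots,n. \]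
   Context: Tropical arithmetic uses $\oplus=\min$, $\odot=+$, with $\infty+t=\infty$ for all $t$. A tropical H-eigenpair of a tensor $A$ of order $m$ and rank $n$ is a pair $(x,\lambda)\in\mathbb{R}^n/\mathbb{R}(1,\ldots,1)\times\mathbb{R}$ satisfying the displayed min-plus equations; $\lambda$ is a tropical H-eigenvalue. Tensors are assumed symmetric in their last $m-1$ indices, i.e. $a_{i_1i_2\cdots i_m}=a_{i_1 i_{\sigma(2)}\cdots i_{\sigma(m)}}$ for all permutations $\sigma$ of $\{2,\ldots,m\}$. *)

theory Defs
  imports "HOL-Analysis.Analysis" "HOL-Combinatorics.Permutations"
begin

text \<open>
  A tensor of order \<open>m\<close> and rank \<open>n = CARD('n)\<close> is a function on index lists, of which only the
  lists of length \<open>m\<close> matter; the list \<open>i # js\<close> with \<open>length js = m - 1\<close> is the index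
  \<open>(i, i\<^sub>2, \<dots>, i\<^sub>m)\<close>.
  Entries lie in the reals together with \<open>\<infinity>\<close>, i.e. in \<^typ>\<open>ereal\<close> without \<open>-\<infinity>\<close>.
\<close>

definition tropical_tensor :: "nat \<Rightarrow> ('n::finite list \<Rightarrow> ereal) \<Rightarrow> bool" where
  "tropical_tensor m A \<longleftrightarrow> (\<forall>is. length is = m \<longrightarrow> A is \<noteq> -\<infinity>)"

text \<open>
  List positions count from \<open>0\<close>, so \<open>{1..<m}\<close> are the last \<open>m - 1\<close> positions.
\<close>

definition symmetric_in_last :: "nat \<Rightarrow> ('n::finite list \<Rightarrow> ereal) \<Rightarrow> bool" where
  "symmetric_in_last m A \<longleftrightarrow>
     (\<forall>\<sigma> is. \<sigma> permutes {1..<m} \<and> length is = m \<longrightarrow> A (permute_list \<sigma> is) = A is)"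

definition support_multisets ::
    "nat \<Rightarrow> ('n::finite list \<Rightarrow> ereal) \<Rightarrow> 'n \<Rightarrow> 'n multiset set" where
  "support_multisets m A i = {mset js | js. length js = m - 1 \<and> A (i # js) \<noteq> \<infinity>}"

text \<open>
  The vector \<open>x\<close> is a representative of a class modulo \<open>(1, \<dots>, 1)\<close>: adding \<open>c\<close> to every
  component adds \<open>(m - 1) * c\<close> to both sides, so the condition depends only on the class.
\<close>

definition tropical_H_eigenpair ::
    "nat \<Rightarrow> ('n::finite list \<Rightarrow> ereal) \<Rightarrow> real ^ 'n \<Rightarrow> real \<Rightarrow> bool" where
  "tropical_H_eigenpair m A x l \<longleftrightarrow>
     (\<forall>i. (MIN js\<in>{js. length js = m - 1}. A (i # js) + ereal (\<Sum>j\<leftarrow>js. x $ j))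
          = ereal (l + real (m - 1) * x $ i))"

definition tropical_H_eigenvalue :: "nat \<Rightarrow> ('n::finite list \<Rightarrow> ereal) \<Rightarrow> real \<Rightarrow> bool" where
  "tropical_H_eigenvalue m A l \<longleftrightarrow> (\<exists>x. tropical_H_eigenpair m A x l)"

end

theory Submission imports Defs begin

text \<open>
  Let \<open>F\<^sub>i(x)\<close> be the left-hand side of the \<open>i\<close>-th eigenvalue equation.  Since all rows have the
  same support, \<open>F\<^sub>i(x) - F\<^sub>j(x)\<close> is bounded by the largest difference of finite entries, uniformly
  in \<open>x\<close>.  So \<open>x \<mapsto> (F(x) - F\<^sub>r(x)) / (m - 1)\<close>, for a fixed row \<open>r\<close>, maps a cube
  into itself, and a Brouwer fixed point of it is an eigenvector.  For uniqueness, let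
  \<open>(x, l)\<close> and \<open>(y, l')\<close> be eigenpairs and compare the equations at an index \<open>i\<close> maximising
  \<open>x\<^sub>i - y\<^sub>i\<close>: as \<open>F\<close> is monotone, this gives \<open>l \<le> l'\<close>.
\<close>

lemma continuous_on_Min:
  fixes f :: "'b \<Rightarrow> 'a::topological_space \<Rightarrow> 'c::linorder_topology"
  assumes "finite L" "L \<noteq> {}" "\<And>s. s \<in> L \<Longrightarrow> continuous_on S (f s)"
  shows "continuous_on S (\<lambda>x. MIN s\<in>L. f s x)"
  using assms by (induction L rule: finite_ne_induct) (auto intro!: continuous_on_min)

lemma Min_le_Min_plus:
  fixes f g :: "'b \<Rightarrow> real"
  assumes "finite L" "L \<noteq> {}" "\<And>s. s \<in> L \<Longrightarrow> f s \<le> g s + c"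
  shows "(MIN s\<in>L. f s) \<le> (MIN s\<in>L. g s) + c"
proof -
  have "(MIN s\<in>L. g s) \<in> g ` L"
    using assms(1,2) by (intro Min_in) auto
  then obtain s where s: "s \<in> L" "(MIN s\<in>L. g s) = g s" by auto
  have "(MIN s\<in>L. f s) \<le> f s"
    using assms(1) s(1) by (intro Min_le) auto
  also have "\<dots> \<le> g s + c" using assms(3) s(1) .
  finally show ?thesis using s(2) by simp
qed

text \<open>Equality of the supports is built into the form of the data: \<open>L\<close> and the
  terms \<open>w s x\<close> are shared by all rows, and only the constants \<open>a i s\<close>
  depend on the row.\<close>

lemma min_plus_eigenpair_exists:
  fixes a :: "'n::finite \<Rightarrow> 'b \<Rightarrow> real" and w :: "'b \<Rightarrow> real ^ 'n \<Rightarrow> real"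
  assumes L: "finite L" "L \<noteq> {}" and k: "k > 0"
    and cont: "\<And>s. s \<in> L \<Longrightarrow> continuous_on UNIV (w s)"
  shows "\<exists>x l. \<forall>i. (MIN s\<in>L. a i s + w s x) = l + k * x $ i"
proof -
  define F where "F x i = (MIN s\<in>L. a i s + w s x)" for x i
  define r :: 'n where "r = undefined"
  define D where "D = (\<lambda>(i, s). \<bar>a i s - a r s\<bar>) ` (UNIV \<times> L)"
  define B where "B = Max D"
  have "finite D" using L(1) by (simp add: D_def)
  then have ab: "\<bar>a i s - a r s\<bar> \<le> B" if "s \<in> L" for i s
    unfolding B_def using that by (intro Max_ge) (auto simp: D_def)
  \<comment> \<open>The term \<open>w s x\<close> cancels when two rows are compared at the same
    \<open>s\<close>, so the bound does not depend on \<open>x\<close>.\<close>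
  have B: "\<bar>F x i - F x r\<bar> \<le> B" for x i
  proof -
    have "a i s + w s x \<le> a r s + w s x + B" "a r s + w s x \<le> a i s + w s x + B"
      if "s \<in> L" for s
      using ab[OF that, of i] by auto
    then have "F x i \<le> F x r + B" "F x r \<le> F x i + B"
      unfolding F_def by (auto intro: Min_le_Min_plus[OF L])
    then show ?thesis by simp
  qed
  have "0 \<le> B" using B[of 0 r] by simp
  define G :: "real ^ 'n \<Rightarrow> real ^ 'n" where "G x = (\<chi> i. (F x i - F x r) / k)" for x
  \<comment> \<open>By the bound \<open>B\<close>, \<open>G\<close> sends every vector into this
    cube.\<close>
  define K :: "(real ^ 'n) set" where "K = cbox (\<chi> i. - (B / k)) (\<chi> i. B / k)"
  have "continuous_on K (\<lambda>x. F x i)" for i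
    unfolding F_def
    using L cont by (intro continuous_on_Min continuous_intros) (auto intro: continuous_on_subset)
  then have "continuous_on K G"
    unfolding G_def using k by (intro continuous_intros) auto
  moreover have "G \<in> K \<rightarrow> K"
  proof
    fix x
    have "\<bar>(F x i - F x r) / k\<bar> \<le> B / k" for i
      using B[of x i] k by (simp add: divide_right_mono)
    then have "- (B / k) \<le> (F x i - F x r) / k" "(F x i - F x r) / k \<le> B / k" for i
      unfolding abs_le_iff by (simp_all add: minus_le_iff)
    then show "G x \<in> K" by (simp add: K_def G_def mem_box_cart)
  qed
  moreover have "0 \<in> K" using k \<open>0 \<le> B\<close> by (simp add: K_def mem_box_cart)
  ultimately obtain x where x: "G x = x"
    using brouwer[of K G] by (auto simp: K_def compact_cbox)
  \<comment> \<open>The subtracted value \<open>F x r\<close> is the eigenvalue of the fixed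
    point.\<close>
  have "F x i = F x r + k * x $ i" for i
  proof -
    have "x $ i = (F x i - F x r) / k" by (subst x[symmetric]) (simp add: G_def)
    then show ?thesis using k by simp
  qed
  then show ?thesis unfolding F_def by blast
qed

text \<open>The assumption on \<open>w\<close> packs monotonicity and homogeneity of degree
  \<open>k\<close> under adding constants into one inequality. Exchanging the two pairs gives
  equality of the eigenvalues.\<close>

lemma min_plus_eigenvalue_le:
  fixes a :: "'n::finite \<Rightarrow> 'b \<Rightarrow> real" and w :: "'b \<Rightarrow> real ^ 'n \<Rightarrow> real"
  assumes L: "finite L" "L \<noteq> {}"
    and w: "\<And>s x y c. s \<in> L \<Longrightarrow> (\<And>j. x $ j \<le> y $ j + c) \<Longrightarrow> w s x \<le> w s y + k * c"
    and x: "\<And>i. (MIN s\<in>L. a i s + w s x) = l + k * x $ i"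
    and y: "\<And>i. (MIN s\<in>L. a i s + w s y) = l' + k * y $ i"
  shows "l \<le> l'"
proof -
  define c where "c = (MAX j. x $ j - y $ j)"
  have "c \<in> range (\<lambda>j. x $ j - y $ j)"
    unfolding c_def by (intro Max_in) auto
  then obtain i where i: "c = x $ i - y $ i" by auto
  have "x $ j - y $ j \<le> c" for j
    unfolding c_def by (intro Max_ge) auto
  then have "x $ j \<le> y $ j + c" for j
    by (simp add: algebra_simps)
  then have "(MIN s\<in>L. a i s + w s x) \<le> (MIN s\<in>L. a i s + w s y) + k * c"
    using w by (intro Min_le_Min_plus[OF L]) (simp add: add.assoc)
  \<comment> \<open>At the maximising \<open>i\<close>, \<open>k * y $ i + k * c\<close> equals
    \<open>k * x $ i\<close>, which cancels.\<close>
  then show ?thesis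
    unfolding x y i by (simp add: algebra_simps)
qed

lemma symmetric_in_last_mset_eq:
  assumes sym: "symmetric_in_last m A" and len: "Suc (length ks) = m"
    and eq: "mset js = mset ks"
  shows "A (i # js) = A (i # ks)"
proof -
  obtain p where p: "p permutes {..<length ks}" "permute_list p ks = js"
    using mset_eq_permutation[OF eq] .
  \<comment> \<open>Conjugating \<open>p\<close> by \<open>Suc\<close> moves it from the positions
    of the tail to those in the full list; position 0, holding \<open>i\<close>, stays
    fixed.\<close>
  define q where "q = map_permutation {..<length ks} Suc p"
  have q: "q permutes {1..<m}"
    unfolding q_def using p(1)
    by (rule map_permutation_permutes[rotated])
      (use len in \<open>auto simp: bij_betw_def lessThan_atLeast0 image_Suc_atLeastLessThan\<close>)
  have "q (Suc j) = Suc (p j)" if "j < length ks" for j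
    unfolding q_def using that by (intro map_permutation_apply) auto
  moreover have "q 0 = 0" using q by (intro permutes_not_in) auto
  ultimately have "permute_list q (i # ks) = i # permute_list p ks"
    by (auto simp: permute_list_def upt_conv_Cons map_Suc_upt[symmetric] simp del: upt_Suc)
  moreover have "A (permute_list q (i # ks)) = A (i # ks)"
    using sym q len by (auto simp: symmetric_in_last_def)
  ultimately show ?thesis using p(2) by simp
qed

lemma sum_list_le_sum_list_plus:
  fixes f g :: "'a \<Rightarrow> real"
  assumes "\<And>j. f j \<le> g j + c"
  shows "(\<Sum>j\<leftarrow>js. f j) \<le> (\<Sum>j\<leftarrow>js. g j) + real (length js) * c"
proof (induction js)
  case (Cons j js)
  then show ?case using assms[of j] by (simp add: algebra_simps)
qed simp

lemma continuous_on_sum_list: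
  fixes f :: "'a \<Rightarrow> 'b::topological_space \<Rightarrow> real"
  assumes "\<And>j. continuous_on S (f j)"
  shows "continuous_on S (\<lambda>x. \<Sum>j\<leftarrow>js. f j x)"
  using assms by (induction js) (auto intro: continuous_on_add)

theorem theorem2:
  fixes A :: "'n::finite list \<Rightarrow> ereal" and m :: nat
  assumes "m \<ge> 2"
    and "tropical_tensor m A"
    and "symmetric_in_last m A"
    and "\<And>i. support_multisets m A i \<noteq> {}"
    and "\<And>i j. support_multisets m A i = support_multisets m A j"
  shows "\<exists>!l::real. tropical_H_eigenvalue m A l"
proof -
  define k where "k = real (m - 1)"
  define w where "w js x = (\<Sum>j\<leftarrow>js. x $ j)" for js and x :: "real ^ 'n"
  define a where "a i js = real_of_ereal (A (i # js))" for i js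
  \<comment> \<open>The support of one arbitrary row, kept as lists because the minimum runs over
    lists; \<open>row\<close> below makes it the support of every row.\<close>
  define L where "L = {js. length js = m - 1 \<and> A (undefined # js) \<noteq> \<infinity>}"
  let ?U = "{js::'n list. length js = m - 1}"
  have U: "finite ?U"
    using finite_lists_length_eq[of "UNIV :: 'n set"] by simp
  have "L \<subseteq> ?U" by (auto simp: L_def)
  then have "finite L" using U by (rule finite_subset)
  moreover have "L \<noteq> {}"
    using assms(4)[of undefined] by (auto simp: L_def support_multisets_def)
  ultimately have L: "finite L" "L \<noteq> {}" .
  \<comment> \<open>Equal supports only yield a rearrangement \<open>ks\<close> of \<open>js\<close>
    with a finite entry in row \<open>i\<close>; symmetry carries finiteness back to
    \<open>js\<close>.\<close>
  have row: "A (i # js) \<noteq> \<infinity>" if "length js = m - 1" "A (j # js) \<noteq> \<infinity>" for i j js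
  proof -
    have "mset js \<in> support_multisets m A j"
      using that by (auto simp: support_multisets_def)
    then have "mset js \<in> support_multisets m A i" using assms(5) by blast
    then obtain ks where ks: "mset js = mset ks" "length ks = m - 1" "A (i # ks) \<noteq> \<infinity>"
      by (auto simp: support_multisets_def)
    have "A (i # js) = A (i # ks)"
      using ks(1,2) assms(1) by (intro symmetric_in_last_mset_eq[OF assms(3)]) auto
    with ks(3) show ?thesis by simp
  qed
  have fin: "A (i # js) = ereal (a i js)" if "js \<in> L" for i js
  proof -
    have "A (i # js) \<noteq> - \<infinity>"
      using that assms(1,2) by (auto simp: L_def tropical_tensor_def)
    then show ?thesis
      using that row by (auto simp: L_def a_def ereal_real)
  qed
  \<comment> \<open>Lists outside \<open>L\<close> contribute infinity, and \<open>L\<close> is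
    nonempty, so the extended minimum is a real minimum over \<open>L\<close>.\<close>
  have "(MIN js\<in>?U. A (i # js) + ereal (\<Sum>j\<leftarrow>js. x $ j))
      = ereal (MIN js\<in>L. a i js + w js x)" (is "_ = ereal ?v") for i x
  proof (rule Min_eqI)
    show "finite ((\<lambda>js. A (i # js) + ereal (\<Sum>j\<leftarrow>js. x $ j)) ` ?U)"
      using U by (rule finite_imageI)
  next
    fix e assume "e \<in> (\<lambda>js. A (i # js) + ereal (\<Sum>j\<leftarrow>js. x $ j)) ` ?U"
    then obtain js where js: "length js = m - 1" "e = A (i # js) + ereal (w js x)"
      by (auto simp: w_def)
    show "ereal ?v \<le> e"
    proof (cases "js \<in> L")
      case True
      then have "?v \<le> a i js + w js x" using L by (intro Min_le) auto
      then show ?thesis using js fin[OF True] by simp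
    next
      case False
      then have "A (i # js) = \<infinity>" using js row by (auto simp: L_def)
      then show ?thesis using js by simp
    qed
  next
    have "?v \<in> (\<lambda>js. a i js + w js x) ` L" using L by (intro Min_in) auto
    then obtain js where js: "js \<in> L" "?v = a i js + w js x" by auto
    then have "ereal ?v = A (i # js) + ereal (\<Sum>j\<leftarrow>js. x $ j)"
      using fin[OF js(1)] by (simp add: w_def)
    then show "ereal ?v \<in> (\<lambda>js. A (i # js) + ereal (\<Sum>j\<leftarrow>js. x $ j)) ` ?U"
      using js(1) \<open>L \<subseteq> ?U\<close> by blast
  qed
  then have pair: "tropical_H_eigenpair m A x l
      \<longleftrightarrow> (\<forall>i. (MIN js\<in>L. a i js + w js x) = l + k * x $ i)" for x l
    unfolding tropical_H_eigenpair_def k_def by simp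
  have "k > 0" using assms(1) by (simp add: k_def)
  moreover have "continuous_on UNIV (w js)" for js
    unfolding w_def by (intro continuous_on_sum_list continuous_intros)
  ultimately have "\<exists>l. tropical_H_eigenvalue m A l"
    using min_plus_eigenpair_exists[OF L, of k w a]
    unfolding tropical_H_eigenvalue_def pair by blast
  moreover have "l \<le> l'"
    if l: "tropical_H_eigenvalue m A l" and l': "tropical_H_eigenvalue m A l'" for l l'
  proof -
    \<comment> \<open>Each of the \<open>m - 1\<close> summands grows by at most \<open>c\<close>,
      whence the factor \<open>k\<close>.\<close>
    have "w js x \<le> w js y + k * c" if "js \<in> L" "\<And>j. x $ j \<le> y $ j + c" for js x y c
      using sum_list_le_sum_list_plus[of "($) x" "($) y" c js] that
      by (auto simp: w_def k_def L_def)
    from min_plus_eigenvalue_le[where w = w and k = k and a = a, OF L this] show ?thesis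
      using l l' unfolding tropical_H_eigenvalue_def pair by blast
  qed
  ultimately show ?thesis by (metis order_antisym)
qed

end
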